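(* Let $1<p<n$, let $\Omega\subset\mathbb{R}^n$ be a bounded open set with smooth boundary (e.g. of class $C^{2,\alpha}$), and let $p<q\le p^*=\frac{np}{n-p}$. Then for every $\lambda\ge\lambda^{\mathcal A}_{1,p}(\Omega)$ the problem $$\Delta^{\mathcal A}_p u = u^{q-1}+\lambda u^{p-1}\ \text{ in }\Omega,\qquad u=0\ \text{ on }\partial\Omega,$$ admits no nontrivial least energy weak solution.
   Context: Notation. $n\ge2$. $\mathbb{S}^{n-1}$ is the unit sphere of $\mathbb{R}^n$ with surface measure $\sigma$; $\omega_s=\pi^{s/2}/\Gamma(\frac s2+1)$ (the volume of the unit ball of $\mathbb{R}^s$ for integer $s$). $W^{1,p}_0(\Omega)$ is the completion of $C_0^\infty(\Omega)$ in the norm $\|\nabla u\|_{L^p(\Omega)}$. For $\xi\in\mathbb{S}^{n-1}$, $\nabla_\xi u=\nabla u\cdot\xi$. Affine $L^p$ energy: for $u\in W^{1,p}_0(\Omega)$, $$\mathcal{E}_{p,\Omega}(u)=\alpha_{n,p}\left(\int_{\mathbb{S}^{n-1}}\left(\int_\Omega|\nabla_\xi u|^p\,dx\right)^{-\frac np}d\sigma(\xi)\right)^{-\frac1n},\quad \alpha_{n,p}=(2\omega_{n+p-2})^{-\frac1p}(n\omega_n\omega_{p-1})^{\frac1p}(n\omega_n)^{\frac1n},$$ with the convention $0^{-n/p}=\infty$, $\infty^{-1/n}=0$ (so $\mathcal{E}_{p,\Omega}(0)=0$). Affine $p$-Laplace operator: for $u\in W^{1,p}_0(\Omega)\setminus\{0\}$,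 $\Delta^{\mathcal A}_p u=-\mathrm{div}\left(H_u^{p-1}(\nabla u)\nabla H_u(\nabla u)\right)$, where for $\zeta\in\mathbb{R}^n$ $$H_u^p(\zeta)=\alpha_{n,p}^{-n}\,\mathcal{E}_{p,\Omega}^{n+p}(u)\int_{\mathbb{S}^{n-1}}\left(\int_\Omega|\nabla_\xi u|^p\,dx\right)^{-\frac{n+p}{p}}|\langle\xi,\zeta\rangle|^p\,d\sigma(\xi),$$ and $H_u^{p-1}\nabla H_u=\frac1p\nabla(H_u^p)$ (equal to $0$ at $\zeta=0$). Principal eigenvalue: $\lambda^{\mathcal A}_{1,p}(\Omega)=\inf\{\mathcal{E}^p_{p,\Omega}(u): u\in W^{1,p}_0(\Omega),\ \|u\|_{L^p(\Omega)}=1\}$. Weak solution: a nonnegative $u_0\in W^{1,p}_0(\Omega)\setminus\{0\}$ with $\int_\Omega H_{u_0}^{p-1}(\nabla u_0)\nabla H_{u_0}(\nabla u_0)\cdot\nabla\varphi\,dx=\int_\Omega u_0^{q-1}\varphi\,dx+\lambda\int_\Omega u_0^{p-1}\varphi\,dx$ for all $\varphi\in W^{1,p}_0(\Omega)$. A least energy weak solution is a nonnegative weak solution that attains $$c_{\mathcal A}=\inf_{u\in W^{1,p}_0(\Omega)\setminus\{0\}}\frac{\mathcal{E}_{p,\Omega}^p(u)-\lambda\int_\Omega|u|^p\,dx}{\left(\int_\Omega|u|^q\,dx\right)^{p/q}}.$$ *)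

theory Defs
  imports "HOL-Analysis.Analysis"
begin

section \<open>Domains with Hoelder regular boundary\<close>

definition grad :: "('a::real_inner \<Rightarrow> real) \<Rightarrow> 'a \<Rightarrow> 'a" where
  "grad f x = (THE D. GDERIV f x :> D)"

text \<open>
  Near each boundary point the set is, in suitable orthonormal coordinates, the region strictly
  above the graph of a \<open>C\<^sup>2\<^sup>,\<^sup>\<alpha>\<close> function. The unit vector \<open>e\<close> is the last coordinate axis; a
  function of the remaining \<open>n - 1\<close> coordinates is a function \<open>\<gamma>\<close> on the whole space that does
  not depend on the component along \<open>e\<close>. \<open>D\<close> and \<open>D2\<close> are the gradient and the Hessian of \<open>\<gamma>\<close>.
\<close>
definition C2_Holder_boundary :: "real \<Rightarrow> 'a::euclidean_space set \<Rightarrow> bool" where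
  "C2_Holder_boundary \<alpha> \<Omega> \<longleftrightarrow>
     (\<forall>x0\<in>frontier \<Omega>. \<exists>r>0. \<exists>e \<gamma> D D2 C.
        norm e = 1 \<and>
        (\<forall>x t. \<gamma> (x + t *\<^sub>R e) = \<gamma> x) \<and>
        (\<forall>x\<in>ball x0 r. GDERIV \<gamma> x :> D x) \<and>
        (\<forall>x\<in>ball x0 r. (D has_derivative D2 x) (at x)) \<and>
        (\<forall>x\<in>ball x0 r. \<forall>y\<in>ball x0 r.
           onorm (\<lambda>v. D2 x v - D2 y v) \<le> C * norm (x - y) powr \<alpha>) \<and>
        \<Omega> \<inter> ball x0 r = {x \<in> ball x0 r. \<gamma> x < x \<bullet> e})"


section \<open>The Sobolev space \<open>W\<^sub>0\<^sup>1\<^sup>,\<^sup>p(\<Omega>)\<close>\<close>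

primrec k_times_continuously_differentiable ::
    "nat \<Rightarrow> ('a::real_normed_vector \<Rightarrow> 'b::real_normed_vector) \<Rightarrow> bool" where
  "k_times_continuously_differentiable 0 f \<longleftrightarrow> continuous_on UNIV f"
| "k_times_continuously_differentiable (Suc k) f \<longleftrightarrow>
     (\<forall>x. f differentiable (at x)) \<and>
     (\<forall>v. k_times_continuously_differentiable k (\<lambda>x. frechet_derivative f (at x) v))"

definition test_functions :: "'a::euclidean_space set \<Rightarrow> ('a \<Rightarrow> real) set" where
  "test_functions \<Omega> =
     {\<phi>. (\<forall>k. k_times_continuously_differentiable k \<phi>) \<and>
          compact (closure {x. \<phi> x \<noteq> 0}) \<and> closure {x. \<phi> x \<noteq> 0} \<subseteq> \<Omega>}"

text \<open>
  The completion of the test functions in the norm \<open>\<parallel>\<nabla>\<phi>\<parallel>\<^sub>p\<close> is realised by functions: on a bounded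
  set the Poincare inequality makes a sequence that is Cauchy in this norm converge in \<open>L\<^sup>p\<close>,
  and an element of the completion is its \<open>L\<^sup>p\<close> limit \<open>u\<close>, with weak gradient the \<open>L\<^sup>p\<close> limit
  \<open>G\<close> of the gradients. Elements are functions on the whole space of which only the
  almost-everywhere class on \<open>\<Omega>\<close> matters.
\<close>
definition W0_gradient ::
    "real \<Rightarrow> 'a::euclidean_space set \<Rightarrow> ('a \<Rightarrow> real) \<Rightarrow> ('a \<Rightarrow> 'a) \<Rightarrow> bool" where
  "W0_gradient p \<Omega> u G \<longleftrightarrow>
     u \<in> borel_measurable (lebesgue_on \<Omega>) \<and> G \<in> borel_measurable (lebesgue_on \<Omega>) \<and>
     (\<exists>\<phi>. (\<forall>k. \<phi> k \<in> test_functions \<Omega>) \<and>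
        (\<lambda>k::nat. \<integral>\<^sup>+x. ennreal (\<bar>\<phi> k x - u x\<bar> powr p) \<partial>lebesgue_on \<Omega>) \<longlonglongrightarrow> 0 \<and>
        (\<lambda>k. \<integral>\<^sup>+x. ennreal (norm (grad (\<phi> k) x - G x) powr p) \<partial>lebesgue_on \<Omega>) \<longlonglongrightarrow> 0)"

definition W0 :: "real \<Rightarrow> 'a::euclidean_space set \<Rightarrow> ('a \<Rightarrow> real) set" where
  "W0 p \<Omega> = {u. \<exists>G. W0_gradient p \<Omega> u G}"

text \<open>Determined up to a null set of \<open>\<Omega>\<close>.\<close>
definition weak_grad :: "real \<Rightarrow> 'a::euclidean_space set \<Rightarrow> ('a \<Rightarrow> real) \<Rightarrow> 'a \<Rightarrow> 'a" where
  "weak_grad p \<Omega> u = (SOME G. W0_gradient p \<Omega> u G)"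

definition W0_nonzero :: "real \<Rightarrow> 'a::euclidean_space set \<Rightarrow> ('a \<Rightarrow> real) set" where
  "W0_nonzero p \<Omega> = {u \<in> W0 p \<Omega>. \<not> (AE x in lebesgue_on \<Omega>. u x = 0)}"

definition Lp_norm :: "real \<Rightarrow> 'a::euclidean_space set \<Rightarrow> ('a \<Rightarrow> real) \<Rightarrow> real" where
  "Lp_norm p \<Omega> u = (\<integral>x. \<bar>u x\<bar> powr p \<partial>lebesgue_on \<Omega>) powr (1 / p)"


section \<open>Affine energy and affine \<open>p\<close>-Laplace operator\<close>

text \<open>
  Surface measure on the unit sphere: \<open>\<sigma>(A)\<close> is \<open>n\<close> times the volume of the cone
  \<open>{x. 0 < |x| < 1 \<and> x / |x| \<in> A}\<close>, that is, the measure for which integration in polar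
  coordinates holds.
\<close>
definition sphere_measure :: "(real^'n) measure" where
  "sphere_measure =
     scale_measure (of_nat CARD('n))
       (distr (restrict_space lborel (ball 0 1 - {0})) (restrict_space borel (sphere 0 1)) sgn)"

definition alpha_const :: "real \<Rightarrow> real \<Rightarrow> real" where
  "alpha_const n p =
     (2 * unit_ball_vol (n + p - 2)) powr (- 1 / p) *
     (n * unit_ball_vol n * unit_ball_vol (p - 1)) powr (1 / p) *
     (n * unit_ball_vol n) powr (1 / n)"

definition directional_energy ::
    "real \<Rightarrow> (real^'n) set \<Rightarrow> (real^'n \<Rightarrow> real) \<Rightarrow> real^'n \<Rightarrow> real" where
  "directional_energy p \<Omega> u \<xi> = (\<integral>x. \<bar>weak_grad p \<Omega> u x \<bullet> \<xi>\<bar> powr p \<partial>lebesgue_on \<Omega>)"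

text \<open>
  The case distinctions implement \<open>0 powr (- n / p) = \<infinity>\<close> and \<open>\<infinity> powr (- 1 / n) = 0\<close>; the real
  \<open>powr\<close> has \<open>0 powr a = 0\<close> for every \<open>a\<close>.
\<close>
definition affine_energy :: "real \<Rightarrow> (real^'n) set \<Rightarrow> (real^'n \<Rightarrow> real) \<Rightarrow> real" where
  "affine_energy p \<Omega> u =
     (let n = real CARD('n);
          J = (\<integral>\<^sup>+\<xi>. (if directional_energy p \<Omega> u \<xi> = 0 then \<infinity>
                     else ennreal (directional_energy p \<Omega> u \<xi> powr (- n / p))) \<partial>sphere_measure)
      in alpha_const n p * (if J = \<infinity> then 0 else enn2real J powr (- 1 / n)))"

text \<open>For \<open>u \<noteq> 0\<close> every directional energy is positive, so no convention is needed here.\<close>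
definition affine_H ::
    "real \<Rightarrow> (real^'n) set \<Rightarrow> (real^'n \<Rightarrow> real) \<Rightarrow> real^'n \<Rightarrow> real" where
  "affine_H p \<Omega> u \<zeta> =
     (let n = real CARD('n)
      in alpha_const n p powr (- n) * affine_energy p \<Omega> u powr (n + p) *
         (\<integral>\<xi>. directional_energy p \<Omega> u \<xi> powr (- (n + p) / p) * \<bar>\<xi> \<bullet> \<zeta>\<bar> powr p \<partial>sphere_measure))
     powr (1 / p)"

definition affine_flux ::
    "real \<Rightarrow> (real^'n) set \<Rightarrow> (real^'n \<Rightarrow> real) \<Rightarrow> real^'n \<Rightarrow> real^'n" where
  "affine_flux p \<Omega> u \<zeta> =
     (if \<zeta> = 0 then 0 else affine_H p \<Omega> u \<zeta> powr (p - 1) *\<^sub>R grad (affine_H p \<Omega> u) \<zeta>)"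


section \<open>Principal eigenvalue and least energy solutions\<close>

definition affine_eigenvalue :: "real \<Rightarrow> (real^'n) set \<Rightarrow> ereal" where
  "affine_eigenvalue p \<Omega> =
     (INF u\<in>{u \<in> W0 p \<Omega>. Lp_norm p \<Omega> u = 1}. ereal (affine_energy p \<Omega> u powr p))"

text \<open>
  The integrability of \<open>u\<^sup>q\<^sup>-\<^sup>1 \<phi>\<close> says that the identity makes sense; Bochner integrals of
  non-integrable functions are \<open>0\<close>. For \<open>q \<le> n p / (n - p)\<close> it is automatic by the Sobolev
  embedding.
\<close>
definition weak_solution ::
    "real \<Rightarrow> real \<Rightarrow> real \<Rightarrow> (real^'n) set \<Rightarrow> (real^'n \<Rightarrow> real) \<Rightarrow> bool" where
  "weak_solution p q lam \<Omega> u \<longleftrightarrow>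
     u \<in> W0_nonzero p \<Omega> \<and> (AE x in lebesgue_on \<Omega>. 0 \<le> u x) \<and>
     (\<forall>\<phi>\<in>W0 p \<Omega>.
        integrable (lebesgue_on \<Omega>) (\<lambda>x. u x powr (q - 1) * \<phi> x) \<and>
        (\<integral>x. affine_flux p \<Omega> u (weak_grad p \<Omega> u x) \<bullet> weak_grad p \<Omega> \<phi> x \<partial>lebesgue_on \<Omega>) =
        (\<integral>x. u x powr (q - 1) * \<phi> x \<partial>lebesgue_on \<Omega>) +
        lam * (\<integral>x. u x powr (p - 1) * \<phi> x \<partial>lebesgue_on \<Omega>))"

definition energy_quotient ::
    "real \<Rightarrow> real \<Rightarrow> real \<Rightarrow> (real^'n) set \<Rightarrow> (real^'n \<Rightarrow> real) \<Rightarrow> real" where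
  "energy_quotient p q lam \<Omega> u =
     (affine_energy p \<Omega> u powr p - lam * (\<integral>x. \<bar>u x\<bar> powr p \<partial>lebesgue_on \<Omega>)) /
     (\<integral>x. \<bar>u x\<bar> powr q \<partial>lebesgue_on \<Omega>) powr (p / q)"

definition least_energy_level :: "real \<Rightarrow> real \<Rightarrow> real \<Rightarrow> (real^'n) set \<Rightarrow> ereal" where
  "least_energy_level p q lam \<Omega> = (INF u\<in>W0_nonzero p \<Omega>. ereal (energy_quotient p q lam \<Omega> u))"

definition least_energy_weak_solution ::
    "real \<Rightarrow> real \<Rightarrow> real \<Rightarrow> (real^'n) set \<Rightarrow> (real^'n \<Rightarrow> real) \<Rightarrow> bool" where
  "least_energy_weak_solution p q lam \<Omega> u \<longleftrightarrow>
     weak_solution p q lam \<Omega> u \<and>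
     ereal (energy_quotient p q lam \<Omega> u) = least_energy_level p q lam \<Omega>"

end

theory Submission
  imports Defs
begin

text \<open>
  A least energy solution would make the least energy level positive, whereas \<open>\<lambda> \<ge> \<lambda>\<^sub>1\<close> makes it
  nonpositive.

  Write \<open>D(\<xi>)\<close> for the directional energy \<open>\<integral> |\<nabla>u \<bullet> \<xi>|\<^sup>p\<close> and \<open>E\<close> for the affine energy of \<open>u\<close>. The flux is
  \<open>\<nabla>(H\<^sup>p) / p\<close> with \<open>H\<^sup>p\<close> homogeneous of degree \<open>p\<close>, so its inner product with \<open>\<nabla>u\<close> is \<open>H\<^sup>p(\<nabla>u)\<close> by
  Euler's identity (\<open>weighted_powr_Euler\<close>), and integration over the domain gives \<open>E\<^sup>p\<close>
  (\<open>integral_affine_flux_inner_weak_grad\<close>). A weak solution tested with itself therefore satisfies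
  \<open>E\<^sup>p - \<lambda> \<integral> u\<^sup>p = \<integral> u\<^sup>q > 0\<close>, and its energy quotient is positive
  (\<open>weak_solution_energy_quotient_pos\<close>).

  On the other hand, functions with \<open>\<integral> |v|\<^sup>p = 1\<close> that are almost optimal for \<open>\<lambda>\<^sub>1\<close> have an energy quotient
  below any given positive number: the numerator is arbitrarily small or negative, and \<open>\<integral> |v|\<^sup>q\<close> is bounded
  from below because the domain has finite measure (\<open>least_energy_level_nonpos\<close>). The argument works with
  almost optimal functions instead of an eigenfunction, so the equality case \<open>\<lambda> = \<lambda>\<^sub>1\<close> involves no
  compactness.

  The analytic point is the differentiability of \<open>H\<close>. It requires the weight \<open>D\<^bsup>-(n+p)/p\<^esup>\<close> to be
  integrable on the sphere. As \<open>D\<close> is continuous, it suffices that \<open>D\<close> has no zero there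
  (\<open>directional_energy_pos\<close>): if \<open>\<nabla>u \<bullet> \<xi> = 0\<close> almost everywhere for one direction \<open>\<xi>\<close>, then \<open>u = 0\<close> by a
  Poincare inequality that only involves the derivative in that direction (\<open>directional_Poincare\<close>).
\<close>

section \<open>Powers of real numbers\<close>

text \<open>An additive form of Hoelder's inequality: on a finite measure space it controls the integral of
  \<open>t\<close> by that of \<open>t\<^sup>r\<close>, with a constant term as small as desired.\<close>
lemma le_add_powr:
  fixes a t r :: real
  assumes "0 < a" "0 \<le> t" "1 < r"
  shows "t \<le> a + a powr (1 - r) * t powr r"
proof (cases "t \<le> a")
  case True
  then show ?thesis by (simp add: add_increasing2)
next
  case False
  have "t = t powr (1 - r) * t powr r"
    using False assms by (simp flip: powr_add)
  also have "\<dots> \<le> a powr (1 - r) * t powr r"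
    using False assms by (intro mult_right_mono powr_mono2') auto
  finally show ?thesis using assms by linarith
qed

lemma DERIV_abs_powr:
  fixes p s :: real
  assumes "1 < p"
  shows "DERIV (\<lambda>t. \<bar>t\<bar> powr p) s :> p * sgn s * \<bar>s\<bar> powr (p - 1)"
proof (cases "s = 0")
  case True
  have "((\<lambda>h. \<bar>h\<bar> powr (p - 1)) \<longlongrightarrow> 0) (at (0::real))"
    using assms by (intro tendsto_zero_powrI[where b = "p - 1"] tendsto_rabs_zero tendsto_ident_at tendsto_const) auto
  moreover have "norm (\<bar>h\<bar> powr p / h) \<le> \<bar>h\<bar> powr (p - 1)" if "h \<noteq> 0" for h :: real
    using that by (simp add: powr_diff)
  then have "eventually (\<lambda>h::real. norm (\<bar>h\<bar> powr p / h) \<le> \<bar>h\<bar> powr (p - 1)) (at 0)"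
    by (simp add: eventually_at_filter)
  ultimately have "((\<lambda>h. \<bar>h\<bar> powr p / h) \<longlongrightarrow> 0) (at (0::real))"
    by (rule Lim_null_comparison[rotated])
  then show ?thesis using True by (simp add: DERIV_def)
next
  case False
  then consider "s > 0" | "s < 0" by linarith
  then show ?thesis
  proof cases
    case 1
    then have "DERIV (\<lambda>t. t powr p) s :> p * sgn s * \<bar>s\<bar> powr (p - 1)"
      by (auto intro!: derivative_eq_intros)
    moreover have "eventually (\<lambda>t. t powr p = \<bar>t\<bar> powr p) (nhds s)"
      using 1 by (intro eventually_mono[OF eventually_nhds_in_open[of "{0<..}" s]]) auto
    ultimately show ?thesis by (subst DERIV_cong_ev[OF refl _ refl, of _ "\<lambda>t. t powr p"])
        (auto elim: eventually_mono)
  next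
    case 2
    then have "DERIV (\<lambda>t. (-t) powr p) s :> p * sgn s * \<bar>s\<bar> powr (p - 1)"
      by (auto intro!: derivative_eq_intros)
    moreover have "eventually (\<lambda>t. (-t) powr p = \<bar>t\<bar> powr p) (nhds s)"
      using 2 by (intro eventually_mono[OF eventually_nhds_in_open[of "{..<0}" s]]) auto
    ultimately show ?thesis by (subst DERIV_cong_ev[OF refl _ refl, of _ "\<lambda>t. (-t) powr p"])
        (auto elim: eventually_mono)
  qed
qed

lemma continuous_on_sgn_mult_abs_powr:
  fixes r :: real
  assumes "0 < r"
  shows "continuous_on UNIV (\<lambda>s::real. sgn s * \<bar>s\<bar> powr r)"
proof -
  have "(\<lambda>s::real. sgn s * \<bar>s\<bar> powr r) = (\<lambda>s. max s 0 powr r - max (- s) 0 powr r)"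
    by (auto simp: fun_eq_iff max_def sgn_if)
  moreover have "continuous_on UNIV (\<lambda>s::real. max s 0 powr r - max (- s) 0 powr r)"
    using assms by (intro continuous_intros continuous_on_powr') auto
  ultimately show ?thesis by (simp only:)
qed

text \<open>The derivative of \<open>|s|\<^sup>p\<close> is uniformly continuous on bounded intervals, so that the mean value
  theorem bounds the remainder uniformly in the base point.\<close>
lemma abs_powr_remainder_uniform:
  fixes p R e :: real
  assumes "1 < p" "0 < e"
  obtains d where "0 < d"
    "\<And>s h. \<bar>s\<bar> \<le> R \<Longrightarrow> \<bar>h\<bar> < d \<Longrightarrow>
      \<bar>\<bar>s + h\<bar> powr p - \<bar>s\<bar> powr p - (p * sgn s * \<bar>s\<bar> powr (p - 1)) * h\<bar> \<le> e * \<bar>h\<bar>"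
proof -
  define g where "g s = p * sgn s * \<bar>s\<bar> powr (p - 1)" for s :: real
  have "continuous_on UNIV (\<lambda>s. p * (sgn s * \<bar>s\<bar> powr (p - 1)))"
    using assms by (intro continuous_intros continuous_on_sgn_mult_abs_powr) auto
  then have "continuous_on (cball 0 (R + 1)) g"
    by (auto simp: g_def mult.assoc elim: continuous_on_subset)
  then have "uniformly_continuous_on (cball 0 (R + 1)) g"
    by (intro compact_uniformly_continuous) auto
  then obtain d where d: "0 < d" "\<And>s t. \<bar>s\<bar> \<le> R + 1 \<Longrightarrow> \<bar>t\<bar> \<le> R + 1 \<Longrightarrow> \<bar>t - s\<bar> < d \<Longrightarrow>
      \<bar>g t - g s\<bar> < e"
    using assms unfolding uniformly_continuous_on_def by (auto simp: dist_real_def)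
  show thesis
  proof (rule that[of "min d 1"])
    fix s h :: real
    assume s: "\<bar>s\<bar> \<le> R" and h: "\<bar>h\<bar> < min d 1"
    have "norm (\<bar>s + h\<bar> powr p - \<bar>s\<bar> powr p - g s * (s + h - s)) \<le> norm (s + h - s) * e"
    proof (rule differentiable_bound_linearization
        [where f' = "\<lambda>t. (\<lambda>k. g t * k)" and S = "closed_segment s (s + h)"])
      fix t assume t: "t \<in> {0..1::real}"
      show "s + t *\<^sub>R (s + h - s) \<in> closed_segment s (s + h)"
        using t by (auto simp: in_segment algebra_simps intro!: exI[of _ t])
    next
      fix t assume "t \<in> closed_segment s (s + h)"
      show "((\<lambda>s. \<bar>s\<bar> powr p) has_derivative (*) (g t)) (at t within closed_segment s (s + h))"
        using DERIV_abs_powr[OF assms(1), of t]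
        by (auto simp: has_field_derivative_def g_def intro: has_derivative_at_withinI)
    next
      fix t assume "t \<in> closed_segment s (s + h)"
      then have "\<bar>t - s\<bar> \<le> \<bar>h\<bar>"
        by (auto simp: closed_segment_eq_real_ivl split: if_splits)
      then have "\<bar>g t - g s\<bar> < e" using s h by (intro d(2)) auto
      then show "onorm ((*) (g t) - (*) (g s)) \<le> e"
        by (intro onorm_le) (simp add: abs_mult mult_right_mono flip: left_diff_distrib)
    qed simp
    then show "\<bar>\<bar>s + h\<bar> powr p - \<bar>s\<bar> powr p - (p * sgn s * \<bar>s\<bar> powr (p - 1)) * h\<bar> \<le> e * \<bar>h\<bar>"
      by (simp add: g_def mult.commute)
  qed (use d in auto)
qed

section \<open>Weighted \<open>p\<close>-th powers of linear functionals\<close>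

lemma integrable_mult_bounded:
  fixes w g :: "'a \<Rightarrow> real"
  assumes "integrable M w" "g \<in> borel_measurable M" "\<And>x. x \<in> space M \<Longrightarrow> \<bar>g x\<bar> \<le> B"
  shows "integrable M (\<lambda>x. w x * g x)"
proof (rule Bochner_Integration.integrable_bound)
  show "integrable M (\<lambda>x. w x * B)" using assms(1) by simp
  show "AE x in M. norm (w x * g x) \<le> norm (w x * B)"
    using assms(3) by (intro AE_I2) (fastforce simp: abs_mult intro!: mult_left_mono)
qed (use assms in measurable)

lemma integrable_weighted_powr_gradient:
  fixes w :: "'a \<Rightarrow> real" and f :: "'a \<Rightarrow> 'b::euclidean_space"
  assumes p: "1 < p" and w: "integrable M w"
    and f: "f \<in> borel_measurable M" "\<And>x. x \<in> space M \<Longrightarrow> norm (f x) \<le> 1"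
  shows "integrable M (\<lambda>x. (w x * (p * sgn (f x \<bullet> \<zeta>) * \<bar>f x \<bullet> \<zeta>\<bar> powr (p - 1))) *\<^sub>R f x)"
proof -
  let ?g = "\<lambda>s. p * sgn s * \<bar>s\<bar> powr (p - 1)"
  have "integrable M (\<lambda>x. w x * ?g (f x \<bullet> \<zeta>))"
  proof (rule integrable_mult_bounded[OF w])
    fix x assume "x \<in> space M"
    then have "\<bar>f x \<bullet> \<zeta>\<bar> \<le> norm \<zeta>"
      using Cauchy_Schwarz_ineq2[of "f x" \<zeta>] f(2) mult_right_mono[of "norm (f x)" 1 "norm \<zeta>"]
      by fastforce
    then show "\<bar>?g (f x \<bullet> \<zeta>)\<bar> \<le> p * norm \<zeta> powr (p - 1)"
      using p by (auto simp: abs_mult abs_sgn_eq intro!: powr_mono2)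
  qed (use f in measurable)
  then show ?thesis
  proof (rule Bochner_Integration.integrable_bound)
    show "AE x in M. norm ((w x * ?g (f x \<bullet> \<zeta>)) *\<^sub>R f x) \<le> norm (w x * ?g (f x \<bullet> \<zeta>))"
      using f(2) by (intro AE_I2) (simp add: mult_left_le)
  qed (use f w in measurable)
qed

text \<open>Since \<open>|f| \<le> 1\<close>, the increment \<open>f x \<bullet> h\<close> is at most \<open>|h|\<close>, and the uniform bound on the
  remainder of \<open>|s|\<^sup>p\<close> can be integrated against the weight.\<close>
lemma GDERIV_weighted_powr:
  fixes w :: "'a \<Rightarrow> real" and f :: "'a \<Rightarrow> 'b::euclidean_space"
  assumes p: "1 < p" and w: "integrable M w" "\<And>x. 0 \<le> w x"
    and f: "f \<in> borel_measurable M" "\<And>x. x \<in> space M \<Longrightarrow> norm (f x) \<le> 1"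
  shows "GDERIV (\<lambda>\<zeta>. \<integral>x. w x * \<bar>f x \<bullet> \<zeta>\<bar> powr p \<partial>M) \<zeta> :>
    (\<integral>x. (w x * (p * sgn (f x \<bullet> \<zeta>) * \<bar>f x \<bullet> \<zeta>\<bar> powr (p - 1))) *\<^sub>R f x \<partial>M)"
proof -
  let ?g = "\<lambda>s. p * sgn s * \<bar>s\<bar> powr (p - 1)"
  have le: "\<bar>f x \<bullet> z\<bar> \<le> norm z" if "x \<in> space M" for x z
    using Cauchy_Schwarz_ineq2[of "f x" z] f(2)[OF that] mult_right_mono[of "norm (f x)" 1 "norm z"]
    by simp
  have iK: "integrable M (\<lambda>x. w x * \<bar>f x \<bullet> z\<bar> powr p)" for z
    using f p le by (intro integrable_mult_bounded[OF w(1), where B = "norm z powr p"])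
      (auto intro!: powr_mono2)
  note iL = integrable_weighted_powr_gradient[OF p w(1) f]
  let ?L = "\<integral>x. (w x * ?g (f x \<bullet> \<zeta>)) *\<^sub>R f x \<partial>M"
  have L: "h \<bullet> ?L = (\<integral>x. w x * ?g (f x \<bullet> \<zeta>) * (f x \<bullet> h) \<partial>M)"
    and iLh: "integrable M (\<lambda>x. w x * ?g (f x \<bullet> \<zeta>) * (f x \<bullet> h))" for h
    using integral_inner_right[OF iL, of h \<zeta>] integrable_inner_right[OF iL, of h \<zeta>]
    by (simp_all add: inner_commute[of h])
  show ?thesis
    unfolding gderiv_def has_derivative_at_alt
  proof (intro conjI allI impI)
    show "bounded_linear (\<lambda>h. h \<bullet> ?L)" by (rule bounded_linear_inner_left)
    fix e :: real assume e: "0 < e"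
    define W where "W = (\<integral>x. w x \<partial>M)"
    have W: "0 \<le> W" unfolding W_def by (simp add: w)
    obtain d where d: "0 < d" "\<And>s h. \<bar>s\<bar> \<le> norm \<zeta> \<Longrightarrow> \<bar>h\<bar> < d \<Longrightarrow>
        \<bar>\<bar>s + h\<bar> powr p - \<bar>s\<bar> powr p - ?g s * h\<bar> \<le> e / (W + 1) * \<bar>h\<bar>"
      using abs_powr_remainder_uniform[OF p, of "e / (W + 1)" "norm \<zeta>"] e W by auto
    show "\<exists>d>0. \<forall>y. norm (y - \<zeta>) < d \<longrightarrow>
        norm ((\<integral>x. w x * \<bar>f x \<bullet> y\<bar> powr p \<partial>M) - (\<integral>x. w x * \<bar>f x \<bullet> \<zeta>\<bar> powr p \<partial>M) - (y - \<zeta>) \<bullet> ?L)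
          \<le> e * norm (y - \<zeta>)"
    proof (intro exI[of _ d] conjI allI impI d(1))
      fix y assume y: "norm (y - \<zeta>) < d"
      define h where "h = y - \<zeta>"
      have eq: "(\<integral>x. w x * \<bar>f x \<bullet> y\<bar> powr p \<partial>M) - (\<integral>x. w x * \<bar>f x \<bullet> \<zeta>\<bar> powr p \<partial>M) - h \<bullet> ?L
          = (\<integral>x. w x * \<bar>f x \<bullet> y\<bar> powr p - w x * \<bar>f x \<bullet> \<zeta>\<bar> powr p
              - w x * ?g (f x \<bullet> \<zeta>) * (f x \<bullet> h) \<partial>M)"
        unfolding L using iK iLh by simp
      have "norm (\<integral>x. w x * \<bar>f x \<bullet> y\<bar> powr p - w x * \<bar>f x \<bullet> \<zeta>\<bar> powr p
              - w x * ?g (f x \<bullet> \<zeta>) * (f x \<bullet> h) \<partial>M) \<le> (\<integral>x. w x * (e / (W + 1) * norm h) \<partial>M)"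
      proof (intro order.trans[OF integral_norm_bound] integral_mono)
        fix x assume x: "x \<in> space M"
        have "\<bar>\<bar>f x \<bullet> \<zeta> + f x \<bullet> h\<bar> powr p - \<bar>f x \<bullet> \<zeta>\<bar> powr p - ?g (f x \<bullet> \<zeta>) * (f x \<bullet> h)\<bar>
            \<le> e / (W + 1) * \<bar>f x \<bullet> h\<bar>"
          using le[OF x, of \<zeta>] le[OF x, of h] y by (intro d(2)) (auto simp: h_def)
        also have "\<dots> \<le> e / (W + 1) * norm h"
          using le[OF x, of h] e W by (intro mult_left_mono) auto
        finally have "w x * \<bar>\<bar>f x \<bullet> \<zeta> + f x \<bullet> h\<bar> powr p - \<bar>f x \<bullet> \<zeta>\<bar> powr p - ?g (f x \<bullet> \<zeta>) * (f x \<bullet> h)\<bar>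
            \<le> w x * (e / (W + 1) * norm h)"
          by (intro mult_left_mono w)
        moreover have "w x * \<bar>f x \<bullet> y\<bar> powr p - w x * \<bar>f x \<bullet> \<zeta>\<bar> powr p - w x * ?g (f x \<bullet> \<zeta>) * (f x \<bullet> h)
          = w x * (\<bar>f x \<bullet> \<zeta> + f x \<bullet> h\<bar> powr p - \<bar>f x \<bullet> \<zeta>\<bar> powr p - ?g (f x \<bullet> \<zeta>) * (f x \<bullet> h))"
          by (simp add: h_def inner_diff_right algebra_simps)
        ultimately show "norm (w x * \<bar>f x \<bullet> y\<bar> powr p - w x * \<bar>f x \<bullet> \<zeta>\<bar> powr p
              - w x * ?g (f x \<bullet> \<zeta>) * (f x \<bullet> h)) \<le> w x * (e / (W + 1) * norm h)"
          using w(2)[of x] by (simp add: abs_mult)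
      qed (use iK iLh w in auto)
      also have "\<dots> = e * norm h * (W / (W + 1))"
        by (simp only: integral_mult_left_zero W_def[symmetric]) simp
      also have "\<dots> \<le> e * norm h"
        using e W by (intro mult_left_le) auto
      finally show "norm ((\<integral>x. w x * \<bar>f x \<bullet> y\<bar> powr p \<partial>M) - (\<integral>x. w x * \<bar>f x \<bullet> \<zeta>\<bar> powr p \<partial>M)
          - (y - \<zeta>) \<bullet> ?L) \<le> e * norm (y - \<zeta>)"
        unfolding h_def[symmetric] eq .
    qed
  qed
qed

lemma grad_eqI: "GDERIV f x :> D \<Longrightarrow> grad f x = D"
  unfolding grad_def
proof (rule the_equality)
  fix E assume "GDERIV f x :> D" "GDERIV f x :> E"
  then have "(\<lambda>h. h \<bullet> E) = (\<lambda>h. h \<bullet> D)"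
    unfolding gderiv_def by (rule has_derivative_unique[rotated])
  then show "E = D" by (metis inner_commute vector_eq_ldot)
qed

text \<open>Euler's identity for the function \<open>H(\<zeta>) = (c \<integral> w |f \<bullet> \<zeta>|\<^sup>p)\<^bsup>1/p\<^esup>\<close>, which is homogeneous of
  degree one: \<open>H\<^bsup>p-1\<^esup> \<nabla>H = \<nabla>(H\<^sup>p) / p\<close>. Where \<open>H\<close> vanishes it need not be differentiable, but there the
  factor \<open>H\<^bsup>p-1\<^esup>\<close> is zero.\<close>
lemma weighted_powr_Euler:
  fixes w :: "'a \<Rightarrow> real" and f :: "'a \<Rightarrow> 'b::euclidean_space"
  assumes p: "1 < p" and w: "integrable M w" "\<And>x. 0 \<le> w x"
    and f: "f \<in> borel_measurable M" "\<And>x. x \<in> space M \<Longrightarrow> norm (f x) \<le> 1"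
    and c: "0 \<le> c"
  defines "H \<equiv> \<lambda>\<zeta>. (c * (\<integral>x. w x * \<bar>f x \<bullet> \<zeta>\<bar> powr p \<partial>M)) powr (1 / p)"
  shows "H \<zeta> powr (p - 1) * (grad H \<zeta> \<bullet> \<zeta>) = c * (\<integral>x. w x * \<bar>f x \<bullet> \<zeta>\<bar> powr p \<partial>M)"
proof -
  let ?K = "\<lambda>\<zeta>. \<integral>x. w x * \<bar>f x \<bullet> \<zeta>\<bar> powr p \<partial>M"
  have K: "0 \<le> ?K \<zeta>" by (simp add: w)
  show ?thesis
  proof (cases "c * ?K \<zeta> = 0")
    case True
    then show ?thesis unfolding H_def True by simp
  next
    case False
    then have pos: "0 < c * ?K \<zeta>" using K c by (simp add: less_le)
    let ?g = "\<lambda>s. p * sgn s * \<bar>s\<bar> powr (p - 1)"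
    let ?L = "\<integral>x. (w x * ?g (f x \<bullet> \<zeta>)) *\<^sub>R f x \<partial>M"
    note iL = integrable_weighted_powr_gradient[OF p w(1) f]
    have "?L \<bullet> \<zeta> = (\<integral>x. w x * ?g (f x \<bullet> \<zeta>) * (f x \<bullet> \<zeta>) \<partial>M)"
      using integral_inner_left[OF iL, of \<zeta> \<zeta>] by simp
    also have "\<dots> = (\<integral>x. p * (w x * \<bar>f x \<bullet> \<zeta>\<bar> powr p) \<partial>M)"
    proof (rule Bochner_Integration.integral_cong[OF refl])
      fix x
      define s where "s = f x \<bullet> \<zeta>"
      have e: "sgn s * \<bar>s\<bar> powr (p - 1) * s = \<bar>s\<bar> powr p"
        by (cases "s = 0") (auto simp: powr_diff sgn_if)
      have "w x * ?g s * s = p * (w x * (sgn s * \<bar>s\<bar> powr (p - 1) * s))"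
        by (simp only: mult_ac)
      then show "w x * ?g (f x \<bullet> \<zeta>) * (f x \<bullet> \<zeta>) = p * (w x * \<bar>f x \<bullet> \<zeta>\<bar> powr p)"
        unfolding e unfolding s_def .
    qed
    finally have L: "?L \<bullet> \<zeta> = p * ?K \<zeta>" by simp
    have "DERIV (\<lambda>t. (c * t) powr (1 / p)) (?K \<zeta>) :> (c * ?K \<zeta>) powr (1 / p - 1) * c / p"
      using pos p by (auto intro!: derivative_eq_intros)
    then have "GDERIV H \<zeta> :> ((c * ?K \<zeta>) powr (1 / p - 1) * c / p) *\<^sub>R ?L"
      unfolding H_def by (intro GDERIV_DERIV_compose[OF GDERIV_weighted_powr] p w f)
    then have "grad H \<zeta> \<bullet> \<zeta> = (c * ?K \<zeta>) powr (1 / p - 1) * (c * ?K \<zeta>)"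
      using L p by (simp add: grad_eqI)
    moreover have "H \<zeta> powr (p - 1) = (c * ?K \<zeta>) powr (1 - 1 / p)"
      using p by (simp add: H_def powr_powr field_simps)
    ultimately have "H \<zeta> powr (p - 1) * (grad H \<zeta> \<bullet> \<zeta>) =
        (c * ?K \<zeta>) powr ((1 - 1 / p) + (1 / p - 1)) * (c * ?K \<zeta>)"
      by (simp only: powr_add mult.assoc)
    then show ?thesis using pos by simp
  qed
qed

section \<open>Test functions\<close>

lemma k_times_continuously_differentiable_imp_GDERIV:
  fixes \<phi> :: "'a::euclidean_space \<Rightarrow> real"
  assumes "k_times_continuously_differentiable (Suc 0) \<phi>"
  shows "GDERIV \<phi> x :> grad \<phi> x" "continuous_on UNIV (grad \<phi>)"
proof -
  define D where "D x = (\<Sum>b\<in>Basis. frechet_derivative \<phi> (at x) b *\<^sub>R b)" for x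
  have D: "GDERIV \<phi> x :> D x" for x
  proof -
    have der: "(\<phi> has_derivative frechet_derivative \<phi> (at x)) (at x)"
      using assms by (simp flip: frechet_derivative_works)
    then have lin: "linear (frechet_derivative \<phi> (at x))"
      by (rule has_derivative_linear)
    have "frechet_derivative \<phi> (at x) h = h \<bullet> D x" for h
    proof -
      have "frechet_derivative \<phi> (at x) h = frechet_derivative \<phi> (at x) (\<Sum>b\<in>Basis. (h \<bullet> b) *\<^sub>R b)"
        by (simp add: euclidean_representation)
      also have "\<dots> = (\<Sum>b\<in>Basis. (h \<bullet> b) * frechet_derivative \<phi> (at x) b)"
        by (simp add: linear_sum[OF lin] linear_scale[OF lin])
      also have "\<dots> = h \<bullet> D x" by (simp add: D_def inner_sum_right mult.commute)
      finally show ?thesis .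
    qed
    then have "frechet_derivative \<phi> (at x) = (\<lambda>h. h \<bullet> D x)" by auto
    then show ?thesis using der by (simp add: gderiv_def)
  qed
  then have eq: "grad \<phi> = D" by (simp add: fun_eq_iff grad_eqI)
  show "GDERIV \<phi> x :> grad \<phi> x" using D by (simp add: eq)
  show "continuous_on UNIV (grad \<phi>)"
    unfolding eq D_def[abs_def] using assms by (intro continuous_intros) simp
qed

lemma test_functionsD:
  assumes "\<phi> \<in> test_functions \<Omega>"
  shows "GDERIV \<phi> x :> grad \<phi> x" "continuous_on UNIV (grad \<phi>)" "continuous_on UNIV \<phi>"
    "x \<notin> \<Omega> \<Longrightarrow> \<phi> x = 0" "x \<notin> \<Omega> \<Longrightarrow> grad \<phi> x = 0"
proof -
  have k: "k_times_continuously_differentiable k \<phi>" for k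
    using assms by (simp add: test_functions_def)
  have supp: "closure {x. \<phi> x \<noteq> 0} \<subseteq> \<Omega>"
    using assms by (simp add: test_functions_def)
  show "GDERIV \<phi> x :> grad \<phi> x" "continuous_on UNIV (grad \<phi>)"
    using k_times_continuously_differentiable_imp_GDERIV[OF k] by auto
  show "continuous_on UNIV \<phi>" using k[of 0] by simp
  show "\<phi> x = 0" if "x \<notin> \<Omega>"
    using that supp closure_subset[of "{x. \<phi> x \<noteq> 0}"] by auto
  show "grad \<phi> x = 0" if "x \<notin> \<Omega>"
  proof (rule grad_eqI)
    have "((\<lambda>y. 0) has_derivative (\<lambda>h. h \<bullet> 0)) (at x)" by simp
    moreover have "open (- closure {x. \<phi> x \<noteq> 0})" by (intro open_Compl closed_closure)
    moreover have "x \<in> - closure {x. \<phi> x \<noteq> 0}" using that supp by auto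
    ultimately show "GDERIV \<phi> x :> 0" unfolding gderiv_def
    proof (rule has_derivative_transform_within_open)
      show "0 = \<phi> y" if "y \<in> - closure {x. \<phi> x \<noteq> 0}" for y
        using that closure_subset[of "{x. \<phi> x \<noteq> 0}"] by auto
    qed
  qed
qed

lemma nn_integral_lebesgue_on_eq_lborel:
  assumes "S \<in> sets lebesgue" "h \<in> borel_measurable borel" "\<And>x. x \<notin> S \<Longrightarrow> h x = 0"
  shows "(\<integral>\<^sup>+x. h x \<partial>lebesgue_on S) = (\<integral>\<^sup>+x. h x \<partial>lborel)"
proof -
  have "(\<integral>\<^sup>+x. h x \<partial>lebesgue_on S) = (\<integral>\<^sup>+x. h x * indicator S x \<partial>lebesgue)"
    using assms by (intro nn_integral_restrict_space) simp
  also have "\<dots> = (\<integral>\<^sup>+x. h x \<partial>lebesgue)"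
    using assms(3) by (intro nn_integral_cong) (auto split: split_indicator)
  also have "\<dots> = (\<integral>\<^sup>+x. h x \<partial>lborel)" by (rule nn_integral_completion)
  finally show ?thesis .
qed

lemma borel_measurable_lebesgue_onI:
  "f \<in> borel_measurable borel \<Longrightarrow> f \<in> borel_measurable (lebesgue_on S)"
  by (intro measurable_restrict_space1 measurable_completion) simp

section \<open>A Poincare inequality in one direction\<close>

text \<open>A point moved by \<open>2R + 1\<close> in the direction \<open>\<xi>\<close> leaves the support, so the fundamental theorem
  of calculus bounds \<open>|\<phi>(x)|\<close> by the integral of \<open>|\<nabla>\<phi> \<bullet> \<xi>|\<close> along the segment. Integration over
  \<open>x\<close> first, which is invariant under translations, makes each point of the segment
  contribute the same amount.\<close>
lemma directional_Poincare:
  fixes \<phi> :: "'a::euclidean_space \<Rightarrow> real"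
  assumes der: "\<And>x. GDERIV \<phi> x :> g x" and cont: "continuous_on UNIV g"
    and supp: "\<And>x. \<phi> x \<noteq> 0 \<Longrightarrow> norm x \<le> R" and R: "0 \<le> R" and \<xi>: "norm \<xi> = 1"
  shows "(\<integral>\<^sup>+x. ennreal \<bar>\<phi> x\<bar> \<partial>lborel) \<le> ennreal (2 * R + 1) * (\<integral>\<^sup>+x. ennreal \<bar>g x \<bullet> \<xi>\<bar> \<partial>lborel)"
proof -
  define T where "T = 2 * R + 1"
  have T: "0 \<le> T" using R by (simp add: T_def)
  have [measurable]: "g \<in> borel_measurable borel"
    using cont by (rule borel_measurable_continuous_onI)
  have pt: "ennreal \<bar>\<phi> x\<bar> \<le> (\<integral>\<^sup>+t. ennreal \<bar>g (x + t *\<^sub>R \<xi>) \<bullet> \<xi>\<bar> * indicator {0..T} t \<partial>lborel)" for x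
  proof (cases "\<phi> x = 0")
    case False
    have "T - norm x \<le> norm (x + T *\<^sub>R \<xi>)"
      using norm_triangle_ineq2[of "T *\<^sub>R \<xi>" "- x"] \<xi> T by (simp add: add.commute)
    then have zero: "\<phi> (x + T *\<^sub>R \<xi>) = 0"
      using supp[OF False] supp[of "x + T *\<^sub>R \<xi>"] T_def by fastforce
    have d: "DERIV (\<lambda>t. \<phi> (x + t *\<^sub>R \<xi>)) t :> g (x + t *\<^sub>R \<xi>) \<bullet> \<xi>" for t
    proof -
      have "((\<lambda>t. \<phi> (x + t *\<^sub>R \<xi>)) has_derivative (\<lambda>h. (h *\<^sub>R \<xi>) \<bullet> g (x + t *\<^sub>R \<xi>))) (at t)"
        using der[of "x + t *\<^sub>R \<xi>"] unfolding gderiv_def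
        by (rule has_derivative_compose[rotated]) (auto intro!: derivative_eq_intros)
      then show ?thesis
        unfolding has_field_derivative_def
        by (rule has_derivative_eq_rhs) (simp add: fun_eq_iff inner_commute)
    qed
    have "continuous_on UNIV (\<lambda>t. g (x + t *\<^sub>R \<xi>) \<bullet> \<xi>)"
      by (intro continuous_intros continuous_on_compose2[OF cont]) auto
    then have c: "isCont (\<lambda>t. g (x + t *\<^sub>R \<xi>) \<bullet> \<xi>) t" for t
      by (simp add: continuous_on_eq_continuous_at)
    have bi: "has_bochner_integral lborel (\<lambda>t. (g (x + t *\<^sub>R \<xi>) \<bullet> \<xi>) * indicator {0..T} t)
        (\<phi> (x + T *\<^sub>R \<xi>) - \<phi> (x + 0 *\<^sub>R \<xi>))"
      using d c by (intro has_bochner_integral_FTC_Icc_real[OF T]) auto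
    have "ennreal (norm (\<phi> (x + T *\<^sub>R \<xi>) - \<phi> (x + 0 *\<^sub>R \<xi>))) \<le>
        (\<integral>\<^sup>+t. norm ((g (x + t *\<^sub>R \<xi>) \<bullet> \<xi>) * indicator {0..T} t) \<partial>lborel)"
      by (rule has_bochner_integral_norm_bound[OF bi])
    also have "\<dots> = (\<integral>\<^sup>+t. ennreal \<bar>g (x + t *\<^sub>R \<xi>) \<bullet> \<xi>\<bar> * indicator {0..T} t \<partial>lborel)"
      by (intro nn_integral_cong) (auto split: split_indicator)
    finally show ?thesis using zero by simp
  qed simp
  have "(\<integral>\<^sup>+x. ennreal \<bar>\<phi> x\<bar> \<partial>lborel) \<le>
      (\<integral>\<^sup>+x. (\<integral>\<^sup>+t. ennreal \<bar>g (x + t *\<^sub>R \<xi>) \<bullet> \<xi>\<bar> * indicator {0..T} t \<partial>lborel) \<partial>lborel)"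
    by (intro nn_integral_mono pt)
  also have "\<dots> = (\<integral>\<^sup>+t. (\<integral>\<^sup>+x. ennreal \<bar>g (x + t *\<^sub>R \<xi>) \<bullet> \<xi>\<bar> * indicator {0..T} t \<partial>lborel) \<partial>lborel)"
    by (intro lborel_pair.Fubini'[symmetric]) measurable
  also have "\<dots> = (\<integral>\<^sup>+t. (\<integral>\<^sup>+x. ennreal \<bar>g x \<bullet> \<xi>\<bar> \<partial>lborel) * indicator {0..T} t \<partial>lborel)"
  proof (intro nn_integral_cong)
    fix t :: real
    have "(\<integral>\<^sup>+x. ennreal \<bar>g x \<bullet> \<xi>\<bar> \<partial>lborel) = (\<integral>\<^sup>+x. ennreal \<bar>g (t *\<^sub>R \<xi> + x) \<bullet> \<xi>\<bar> \<partial>lborel)"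
      by (subst lborel_distr_plus[of "t *\<^sub>R \<xi>", symmetric]) (simp add: nn_integral_distr)
    then show "(\<integral>\<^sup>+x. ennreal \<bar>g (x + t *\<^sub>R \<xi>) \<bullet> \<xi>\<bar> * indicator {0..T} t \<partial>lborel) =
        (\<integral>\<^sup>+x. ennreal \<bar>g x \<bullet> \<xi>\<bar> \<partial>lborel) * indicator {0..T} t"
      by (simp add: nn_integral_multc add.commute)
  qed
  also have "\<dots> = (\<integral>\<^sup>+x. ennreal \<bar>g x \<bullet> \<xi>\<bar> \<partial>lborel) * ennreal T"
    using T by (subst nn_integral_cmult) (auto simp: emeasure_lborel_Icc)
  finally show ?thesis by (simp add: T_def mult.commute)
qed

section \<open>Convergence in the mean on a finite measure space\<close>

text \<open>Convergence in \<open>L\<^sup>p\<close> implies convergence in \<open>L\<^sup>1\<close>, stated for nonnegative integrals, which need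
  no integrability of the functions.\<close>
lemma nn_integral_powr_tendsto_0_imp_tendsto_0:
  fixes f :: "nat \<Rightarrow> 'a \<Rightarrow> real"
  assumes "finite_measure M" "1 < p"
    and meas[measurable]: "\<And>k. f k \<in> borel_measurable M" and nonneg: "\<And>k x. 0 \<le> f k x"
    and lim: "(\<lambda>k. \<integral>\<^sup>+x. ennreal (f k x powr p) \<partial>M) \<longlonglongrightarrow> 0"
  shows "(\<lambda>k. \<integral>\<^sup>+x. ennreal (f k x) \<partial>M) \<longlonglongrightarrow> 0"
proof (rule order_tendstoI)
  interpret finite_measure M by fact
  fix e :: ennreal assume "0 < e"
  then obtain \<epsilon> :: real where \<epsilon>: "0 < \<epsilon>" "ennreal \<epsilon> < e"
    by (metis dense ennreal_cases ennreal_less_zero_iff less_top_ennreal order_less_trans top.extremum_strict)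
  \<comment> \<open>With this \<open>a\<close> the constant term in the bound \<open>t \<le> a + a\<^bsup>1-p\<^esup> t\<^sup>p\<close> contributes at most \<open>\<epsilon> / 2\<close>.\<close>
  define m where "m = measure M (space M)"
  define a where "a = \<epsilon> / (2 * (m + 1))"
  have m: "0 \<le> m" "emeasure M (space M) = ennreal m"
    by (simp_all add: m_def emeasure_eq_measure)
  have a: "0 < a" "a * m \<le> \<epsilon> / 2" using \<epsilon> m by (auto simp: a_def field_simps)
  define c where "c = a powr (1 - p)"
  have c: "0 < c" using a by (simp add: c_def)
  have "eventually (\<lambda>k. (\<integral>\<^sup>+x. ennreal (f k x powr p) \<partial>M) < ennreal (\<epsilon> / 2 / c)) sequentially"
    using order_tendstoD(2)[OF lim] \<epsilon> c by simp
  then show "eventually (\<lambda>k. (\<integral>\<^sup>+x. ennreal (f k x) \<partial>M) < e) sequentially"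
  proof eventually_elim
    fix k assume k: "(\<integral>\<^sup>+x. ennreal (f k x powr p) \<partial>M) < ennreal (\<epsilon> / 2 / c)"
    have "(\<integral>\<^sup>+x. ennreal (f k x) \<partial>M) \<le> (\<integral>\<^sup>+x. ennreal a + ennreal c * ennreal (f k x powr p) \<partial>M)"
    proof (intro nn_integral_mono)
      fix x
      have "f k x \<le> a + c * f k x powr p"
        unfolding c_def by (intro le_add_powr a nonneg assms)
      then show "ennreal (f k x) \<le> ennreal a + ennreal c * ennreal (f k x powr p)"
        using a c by (simp flip: ennreal_plus ennreal_mult)
    qed
    also have "\<dots> = ennreal a * ennreal m + ennreal c * (\<integral>\<^sup>+x. ennreal (f k x powr p) \<partial>M)"
      by (simp add: nn_integral_add nn_integral_cmult m)
    also have "\<dots> \<le> ennreal (\<epsilon> / 2) + ennreal c * ennreal (\<epsilon> / 2 / c)"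
      using a m k by (intro add_mono mult_left_mono) (auto simp flip: ennreal_mult intro: ennreal_leI)
    also have "\<dots> = ennreal \<epsilon>"
      using c \<epsilon> by (simp flip: ennreal_mult ennreal_plus)
    finally show "(\<integral>\<^sup>+x. ennreal (f k x) \<partial>M) < e" using \<epsilon> by simp
  qed
qed simp

section \<open>Gradients in the Sobolev space\<close>

lemma finite_measure_lebesgue_on_open_bounded:
  "open \<Omega> \<Longrightarrow> bounded \<Omega> \<Longrightarrow> finite_measure (lebesgue_on \<Omega>)" for \<Omega> :: "'a::euclidean_space set"
  by (intro finite_measure_lebesgue_on lmeasurable_open)

text \<open>A gradient differs by a \<open>p\<close>-integrable function from the gradient of a test function, which is
  bounded.\<close>
lemma W0_gradient_integrable:
  fixes \<Omega> :: "'a::euclidean_space set"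
  assumes "open \<Omega>" "bounded \<Omega>" "1 < p" "W0_gradient p \<Omega> u G"
  shows "integrable (lebesgue_on \<Omega>) (\<lambda>x. norm (G x) powr p)"
proof -
  interpret finite_measure "lebesgue_on \<Omega>"
    using assms by (intro finite_measure_lebesgue_on_open_bounded)
  have [measurable]: "G \<in> borel_measurable (lebesgue_on \<Omega>)"
    using assms by (simp add: W0_gradient_def)
  obtain \<phi> where \<phi>: "\<And>k::nat. \<phi> k \<in> test_functions \<Omega>"
    and lim: "(\<lambda>k. \<integral>\<^sup>+x. ennreal (norm (grad (\<phi> k) x - G x) powr p) \<partial>lebesgue_on \<Omega>) \<longlonglongrightarrow> 0"
    using assms(4) unfolding W0_gradient_def by auto
  have "eventually (\<lambda>k. (\<integral>\<^sup>+x. ennreal (norm (grad (\<phi> k) x - G x) powr p) \<partial>lebesgue_on \<Omega>) < 1) sequentially"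
    using order_tendstoD(2)[OF lim, of 1] by simp
  then obtain k where k: "(\<integral>\<^sup>+x. ennreal (norm (grad (\<phi> k) x - G x) powr p) \<partial>lebesgue_on \<Omega>) < 1"
    by (meson eventually_happens sequentially_bot)
  define g where "g = grad (\<phi> k)"
  have cont: "continuous_on UNIV g" using test_functionsD(2)[OF \<phi>] by (simp add: g_def)
  have [measurable]: "g \<in> borel_measurable (lebesgue_on \<Omega>)"
    using cont by (intro borel_measurable_lebesgue_onI borel_measurable_continuous_onI)
  have "compact (g ` closure \<Omega>)"
    using assms cont by (intro compact_continuous_image) (auto elim: continuous_on_subset)
  then obtain B where B: "\<And>x. x \<in> \<Omega> \<Longrightarrow> norm (g x) \<le> B"
    using closure_subset[of \<Omega>] by (fastforce dest: compact_imp_bounded simp: bounded_iff)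
  have "integrable (lebesgue_on \<Omega>) (\<lambda>x. norm (g x - G x) powr p)"
    using k[folded g_def] by (intro integrableI_nonneg) (auto intro: order.strict_trans)
  moreover have "integrable (lebesgue_on \<Omega>) (\<lambda>x. norm (g x) powr p)"
    using B assms by (intro integrable_const_bound[where B = "B powr p"])
      (auto intro!: powr_mono2 AE_I2)
  ultimately have "integrable (lebesgue_on \<Omega>)
      (\<lambda>x. 2 powr p * (norm (g x - G x) powr p + norm (g x) powr p))"
    by simp
  then show ?thesis
  proof (rule Bochner_Integration.integrable_bound)
    have "norm (G x) powr p \<le> 2 powr p * (norm (g x - G x) powr p + norm (g x) powr p)" for x
    proof -
      let ?a = "norm (g x - G x)" and ?b = "norm (g x)"
      have "norm (G x) \<le> ?a + ?b"
        using norm_triangle_ineq4[of "g x" "g x - G x"] by simp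
      also have "\<dots> \<le> 2 * max ?a ?b" by simp
      finally have "norm (G x) powr p \<le> (2 * max ?a ?b) powr p"
        using assms by (intro powr_mono2) auto
      also have "\<dots> \<le> 2 powr p * (?a powr p + ?b powr p)"
        by (auto simp: powr_mult max_def)
      finally show ?thesis .
    qed
    then show "AE x in lebesgue_on \<Omega>. norm (norm (G x) powr p)
        \<le> norm (2 powr p * (norm (g x - G x) powr p + norm (g x) powr p))"
      by (intro AE_I2) simp
  qed measurable
qed

text \<open>The test functions that approximate \<open>u\<close> have directional derivatives that tend to zero in the
  mean; by the directional Poincare inequality so do the test functions.\<close>
lemma W0_gradient_inner_eq_0_imp_eq_0:
  fixes \<Omega> :: "'a::euclidean_space set"
  assumes "open \<Omega>" "bounded \<Omega>" "1 < p" "W0_gradient p \<Omega> u G" "norm \<xi> = 1"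
    and zero: "AE x in lebesgue_on \<Omega>. G x \<bullet> \<xi> = 0"
  shows "AE x in lebesgue_on \<Omega>. u x = 0"
proof -
  let ?M = "lebesgue_on \<Omega>"
  interpret finite_measure ?M
    using assms by (intro finite_measure_lebesgue_on_open_bounded)
  have [measurable]: "G \<in> borel_measurable ?M" "u \<in> borel_measurable ?M"
    using assms by (simp_all add: W0_gradient_def)
  obtain \<phi> where \<phi>: "\<And>k::nat. \<phi> k \<in> test_functions \<Omega>"
    and lim0: "(\<lambda>k. \<integral>\<^sup>+x. ennreal (\<bar>\<phi> k x - u x\<bar> powr p) \<partial>?M) \<longlonglongrightarrow> 0"
    and lim1: "(\<lambda>k. \<integral>\<^sup>+x. ennreal (norm (grad (\<phi> k) x - G x) powr p) \<partial>?M) \<longlonglongrightarrow> 0"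
    using assms(4) unfolding W0_gradient_def by auto
  note \<phi>D = test_functionsD[OF \<phi>]
  have bm: "\<phi> k \<in> borel_measurable borel" "grad (\<phi> k) \<in> borel_measurable borel" for k
    using \<phi>D(2,3) by (auto intro: borel_measurable_continuous_onI)
  have [measurable]: "\<phi> k \<in> borel_measurable ?M" "grad (\<phi> k) \<in> borel_measurable ?M" for k
    by (intro borel_measurable_lebesgue_onI bm)+
  obtain R where R: "0 < R" "\<And>x. x \<in> \<Omega> \<Longrightarrow> norm x \<le> R"
    using assms(2) by (auto simp: bounded_pos)
  define A where "A k = (\<integral>\<^sup>+x. ennreal \<bar>\<phi> k x - u x\<bar> \<partial>?M)" for k
  define B where "B k = (\<integral>\<^sup>+x. ennreal (norm (grad (\<phi> k) x - G x)) \<partial>?M)" for k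
  have A: "A \<longlonglongrightarrow> 0"
    unfolding A_def[abs_def]
    by (rule nn_integral_powr_tendsto_0_imp_tendsto_0[OF _ assms(3) _ _ lim0]) (simp_all add: finite_measure_axioms)
  have B: "B \<longlonglongrightarrow> 0"
    unfolding B_def[abs_def]
    by (rule nn_integral_powr_tendsto_0_imp_tendsto_0[OF _ assms(3) _ _ lim1]) (simp_all add: finite_measure_axioms)
  have le: "(\<integral>\<^sup>+x. ennreal \<bar>u x\<bar> \<partial>?M) \<le> A k + ennreal (2 * R + 1) * B k" for k
  proof -
    have "(\<integral>\<^sup>+x. ennreal \<bar>u x\<bar> \<partial>?M) \<le> (\<integral>\<^sup>+x. ennreal \<bar>\<phi> k x - u x\<bar> + ennreal \<bar>\<phi> k x\<bar> \<partial>?M)"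
      by (intro nn_integral_mono) (auto simp flip: ennreal_plus intro!: ennreal_leI)
    also have "\<dots> = A k + (\<integral>\<^sup>+x. ennreal \<bar>\<phi> k x\<bar> \<partial>?M)"
      unfolding A_def by (rule nn_integral_add) measurable
    also have "(\<integral>\<^sup>+x. ennreal \<bar>\<phi> k x\<bar> \<partial>?M) = (\<integral>\<^sup>+x. ennreal \<bar>\<phi> k x\<bar> \<partial>lborel)"
      using assms(1) bm[of k] \<phi>D(4)[of _ k] by (intro nn_integral_lebesgue_on_eq_lborel) auto
    also have "\<dots> \<le> ennreal (2 * R + 1) * (\<integral>\<^sup>+x. ennreal \<bar>grad (\<phi> k) x \<bullet> \<xi>\<bar> \<partial>lborel)"
      using R \<phi>D(4)[of _ k] assms(5) by (intro directional_Poincare \<phi>D) auto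
    also have "(\<integral>\<^sup>+x. ennreal \<bar>grad (\<phi> k) x \<bullet> \<xi>\<bar> \<partial>lborel) = (\<integral>\<^sup>+x. ennreal \<bar>grad (\<phi> k) x \<bullet> \<xi>\<bar> \<partial>?M)"
      using assms(1) bm[of k] \<phi>D(5)[of _ k]
      by (intro nn_integral_lebesgue_on_eq_lborel[symmetric]) auto
    also have "\<dots> \<le> B k"
      unfolding B_def
    proof (rule nn_integral_mono_AE)
      show "AE x in ?M. ennreal \<bar>grad (\<phi> k) x \<bullet> \<xi>\<bar> \<le> ennreal (norm (grad (\<phi> k) x - G x))"
        using zero
      proof eventually_elim
        fix x assume "G x \<bullet> \<xi> = 0"
        then show "ennreal \<bar>grad (\<phi> k) x \<bullet> \<xi>\<bar> \<le> ennreal (norm (grad (\<phi> k) x - G x))"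
          using Cauchy_Schwarz_ineq2[of "grad (\<phi> k) x - G x" \<xi>] assms(5)
          by (intro ennreal_leI) (simp add: inner_diff_left)
      qed
    qed
    finally show ?thesis by (simp add: add_left_mono mult_left_mono)
  qed
  have "(\<lambda>k. A k + ennreal (2 * R + 1) * B k) \<longlonglongrightarrow> 0 + ennreal (2 * R + 1) * 0"
    by (intro tendsto_add ennreal_tendsto_cmult A B) simp
  then have "(\<integral>\<^sup>+x. ennreal \<bar>u x\<bar> \<partial>?M) \<le> 0 + ennreal (2 * R + 1) * 0"
    by (rule LIMSEQ_le_const) (use le in auto)
  then have "(\<integral>\<^sup>+x. ennreal \<bar>u x\<bar> \<partial>?M) = 0" by simp
  then show ?thesis by (subst (asm) nn_integral_0_iff_AE) auto
qed

text \<open>With the weight \<open>|G|\<^sup>p\<close> and the field \<open>G / |G|\<close> of norm at most one the integral is of the kind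
  whose differentiability is known.\<close>
lemma continuous_on_integral_abs_inner_powr:
  fixes G :: "'a \<Rightarrow> 'b::euclidean_space"
  assumes "1 < p" and [measurable]: "G \<in> borel_measurable M"
    and "integrable M (\<lambda>x. norm (G x) powr p)"
  shows "continuous_on UNIV (\<lambda>\<xi>. \<integral>x. \<bar>G x \<bullet> \<xi>\<bar> powr p \<partial>M)"
proof -
  have eq: "\<bar>G x \<bullet> \<xi>\<bar> powr p = norm (G x) powr p * \<bar>sgn (G x) \<bullet> \<xi>\<bar> powr p" for x \<xi>
    by (cases "G x = 0") (simp_all add: sgn_div_norm abs_mult field_simps flip: powr_mult)
  have "isCont (\<lambda>\<xi>. \<integral>x. \<bar>G x \<bullet> \<xi>\<bar> powr p \<partial>M) \<xi>" for \<xi>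
    unfolding eq
  proof (rule has_derivative_continuous)
    show "((\<lambda>\<xi>. \<integral>x. norm (G x) powr p * \<bar>sgn (G x) \<bullet> \<xi>\<bar> powr p \<partial>M) has_derivative
      (\<lambda>h. h \<bullet> (\<integral>x. (norm (G x) powr p * (p * sgn (sgn (G x) \<bullet> \<xi>) * \<bar>sgn (G x) \<bullet> \<xi>\<bar> powr (p - 1)))
         *\<^sub>R sgn (G x) \<partial>M))) (at \<xi>)"
      using assms unfolding gderiv_def[symmetric]
      by (intro GDERIV_weighted_powr) (auto simp: norm_sgn)
  qed
  then show ?thesis by (simp add: continuous_on_eq_continuous_at)
qed

section \<open>Directional energies on the sphere\<close>

lemma space_sphere_measure: "space sphere_measure = (sphere 0 1 :: (real^'n) set)"
  by (simp add: sphere_measure_def space_scale_measure space_restrict_space)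

lemma borel_measurable_sphere_measureI:
  assumes "f \<in> borel_measurable (borel :: (real^'n) measure)"
  shows "f \<in> borel_measurable sphere_measure"
proof -
  have "sets (sphere_measure :: (real^'n) measure) = sets (restrict_space borel (sphere 0 1))"
    by (simp add: sphere_measure_def)
  then show ?thesis
    using measurable_restrict_space1[OF assms] by (subst measurable_cong_sets[OF _ refl])
qed

lemma finite_measure_sphere_measure: "finite_measure (sphere_measure :: (real^'n) measure)"
proof
  let ?B = "restrict_space lborel (ball 0 1 - {0}) :: (real^'n) measure"
  have "sgn \<in> measurable ?B (restrict_space borel (sphere 0 1))"
    by (intro measurable_restrict_space2 measurable_restrict_space1)
      (auto simp: space_restrict_space norm_sgn)
  then have "emeasure (distr ?B (restrict_space borel (sphere 0 1)) sgn) (sphere 0 1) =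
      emeasure ?B (sgn -` sphere 0 1 \<inter> space ?B)"
    by (intro emeasure_distr) (auto simp: sets_restrict_space)
  also have "\<dots> \<le> emeasure ?B (space ?B)"
    by (rule emeasure_space)
  also have "\<dots> \<le> emeasure lborel (ball 0 1 :: (real^'n) set)"
    by (auto simp: emeasure_restrict_space space_restrict_space intro!: emeasure_mono)
  also have "\<dots> < \<infinity>" using emeasure_lborel_ball_finite by simp
  finally show "emeasure (sphere_measure :: (real^'n) measure) (space sphere_measure) \<noteq> \<infinity>"
    unfolding space_sphere_measure by (simp add: sphere_measure_def ennreal_mult_eq_top_iff)
qed

lemma weak_grad_W0: "u \<in> W0 p \<Omega> \<Longrightarrow> W0_gradient p \<Omega> u (weak_grad p \<Omega> u)"
  unfolding W0_def weak_grad_def by (auto intro: someI[of "W0_gradient p \<Omega> u"])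

lemma continuous_on_directional_energy:
  assumes "open \<Omega>" "bounded \<Omega>" "1 < p" "u \<in> W0 p \<Omega>"
  shows "continuous_on UNIV (directional_energy p \<Omega> u)"
proof -
  have G: "W0_gradient p \<Omega> u (weak_grad p \<Omega> u)" using assms by (intro weak_grad_W0)
  then have "weak_grad p \<Omega> u \<in> borel_measurable (lebesgue_on \<Omega>)" by (simp add: W0_gradient_def)
  then show ?thesis
    unfolding directional_energy_def[abs_def]
    using G assms by (intro continuous_on_integral_abs_inner_powr W0_gradient_integrable)
qed

lemma integrable_abs_inner_weak_grad_powr:
  fixes \<Omega> :: "(real^'n) set"
  assumes "open \<Omega>" "bounded \<Omega>" "1 < p" "u \<in> W0 p \<Omega>" "norm \<xi> = 1"
  shows "integrable (lebesgue_on \<Omega>) (\<lambda>x. \<bar>weak_grad p \<Omega> u x \<bullet> \<xi>\<bar> powr p)"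
proof -
  have G: "W0_gradient p \<Omega> u (weak_grad p \<Omega> u)" using assms by (intro weak_grad_W0)
  have [measurable]: "weak_grad p \<Omega> u \<in> borel_measurable (lebesgue_on \<Omega>)"
    using G by (simp add: W0_gradient_def)
  show ?thesis
  proof (rule Bochner_Integration.integrable_bound)
    show "integrable (lebesgue_on \<Omega>) (\<lambda>x. norm (weak_grad p \<Omega> u x) powr p)"
      using assms G by (intro W0_gradient_integrable)
    show "AE x in lebesgue_on \<Omega>. norm (\<bar>weak_grad p \<Omega> u x \<bullet> \<xi>\<bar> powr p) \<le> norm (norm (weak_grad p \<Omega> u x) powr p)"
      using assms Cauchy_Schwarz_ineq2[of _ \<xi>] by (intro AE_I2) (auto intro!: powr_mono2)
  qed measurable
qed

lemma directional_energy_pos: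
  assumes "open \<Omega>" "bounded \<Omega>" "1 < p" "u \<in> W0_nonzero p \<Omega>" "norm \<xi> = 1"
  shows "0 < directional_energy p \<Omega> u \<xi>"
proof (rule ccontr)
  have u: "u \<in> W0 p \<Omega>" using assms by (simp add: W0_nonzero_def)
  assume "\<not> 0 < directional_energy p \<Omega> u \<xi>"
  moreover have "0 \<le> directional_energy p \<Omega> u \<xi>" by (simp add: directional_energy_def)
  ultimately have "directional_energy p \<Omega> u \<xi> = 0" by simp
  then have "AE x in lebesgue_on \<Omega>. \<bar>weak_grad p \<Omega> u x \<bullet> \<xi>\<bar> powr p = 0"
    unfolding directional_energy_def
    using integrable_abs_inner_weak_grad_powr[OF assms(1-3) u assms(5)]
    by (subst (asm) integral_nonneg_eq_0_iff_AE) auto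
  then have "AE x in lebesgue_on \<Omega>. weak_grad p \<Omega> u x \<bullet> \<xi> = 0" by simp
  then have "AE x in lebesgue_on \<Omega>. u x = 0"
    by (rule W0_gradient_inner_eq_0_imp_eq_0[OF assms(1-3) weak_grad_W0[OF u] assms(5)])
  then show False using assms(4) by (simp add: W0_nonzero_def)
qed

text \<open>The directional energy is continuous and positive on the compact sphere, hence bounded away from
  zero and infinity there.\<close>
lemma integrable_directional_energy_powr:
  fixes \<Omega> :: "(real^'n) set"
  assumes "open \<Omega>" "bounded \<Omega>" "1 < p" "u \<in> W0_nonzero p \<Omega>"
  shows "integrable sphere_measure (\<lambda>\<xi>. directional_energy p \<Omega> u \<xi> powr r)"
proof -
  let ?D = "directional_energy p \<Omega> u"
  interpret finite_measure "sphere_measure :: (real^'n) measure"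
    by (rule finite_measure_sphere_measure)
  have c: "continuous_on UNIV ?D"
    using assms by (intro continuous_on_directional_energy) (auto simp: W0_nonzero_def)
  have "continuous_on (sphere 0 1) (\<lambda>\<xi>. ?D \<xi> powr r)"
    using directional_energy_pos[OF assms]
    by (intro continuous_intros continuous_on_subset[OF c]) fastforce+
  then have "compact ((\<lambda>\<xi>. ?D \<xi> powr r) ` sphere 0 1)"
    by (intro compact_continuous_image) auto
  then obtain B where "\<And>\<xi>. \<xi> \<in> sphere 0 1 \<Longrightarrow> norm (?D \<xi> powr r) \<le> B"
    by (fastforce dest: compact_imp_bounded simp: bounded_iff)
  moreover have "(\<lambda>\<xi>. ?D \<xi> powr r) \<in> borel_measurable sphere_measure"
    using borel_measurable_continuous_onI[OF c] by (intro borel_measurable_sphere_measureI) measurable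
  ultimately show ?thesis
    by (intro integrable_const_bound[where B = B]) (auto simp: space_sphere_measure intro!: AE_I2)
qed

section \<open>The affine energy as a weak form\<close>

lemma affine_energy_nonneg: "0 \<le> affine_energy p \<Omega> u"
  by (simp add: affine_energy_def Let_def alpha_const_def)

text \<open>For \<open>u \<noteq> 0\<close> the conventions about \<open>0\<close> and \<open>\<infinity>\<close> never apply.\<close>
lemma affine_energy_eq:
  fixes \<Omega> :: "(real^'n) set"
  assumes "open \<Omega>" "bounded \<Omega>" "1 < p" "u \<in> W0_nonzero p \<Omega>"
  shows "affine_energy p \<Omega> u = alpha_const (real CARD('n)) p *
    (\<integral>\<xi>. directional_energy p \<Omega> u \<xi> powr (- real CARD('n) / p) \<partial>sphere_measure) powr (- 1 / real CARD('n))"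
proof -
  let ?D = "directional_energy p \<Omega> u" and ?n = "real CARD('n)"
  have "(\<integral>\<^sup>+\<xi>. (if ?D \<xi> = 0 then \<infinity> else ennreal (?D \<xi> powr (- ?n / p))) \<partial>sphere_measure)
      = (\<integral>\<^sup>+\<xi>. ennreal (?D \<xi> powr (- ?n / p)) \<partial>sphere_measure)"
    using directional_energy_pos[OF assms]
    by (intro nn_integral_cong) (fastforce simp: space_sphere_measure)
  also have "\<dots> = ennreal (\<integral>\<xi>. ?D \<xi> powr (- ?n / p) \<partial>sphere_measure)"
    by (intro nn_integral_eq_integral integrable_directional_energy_powr assms) simp
  finally show ?thesis
    by (simp add: affine_energy_def Let_def)
qed

lemma affine_flux_inner_self:
  fixes \<Omega> :: "(real^'n) set" and \<zeta> :: "real^'n"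
  assumes "open \<Omega>" "bounded \<Omega>" "1 < p" "u \<in> W0_nonzero p \<Omega>"
  defines "n \<equiv> real CARD('n)"
  shows "affine_flux p \<Omega> u \<zeta> \<bullet> \<zeta> = alpha_const n p powr (- n) * affine_energy p \<Omega> u powr (n + p) *
    (\<integral>\<xi>. directional_energy p \<Omega> u \<xi> powr (- (n + p) / p) * \<bar>\<xi> \<bullet> \<zeta>\<bar> powr p \<partial>sphere_measure)"
proof (cases "\<zeta> = 0")
  case True
  then show ?thesis by (simp add: affine_flux_def)
next
  case False
  define c where "c = alpha_const n p powr (- n) * affine_energy p \<Omega> u powr (n + p)"
  have H: "affine_H p \<Omega> u = (\<lambda>\<zeta>. (c * (\<integral>\<xi>. directional_energy p \<Omega> u \<xi> powr (- (n + p) / p) *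
      \<bar>\<xi> \<bullet> \<zeta>\<bar> powr p \<partial>sphere_measure)) powr (1 / p))"
    by (simp add: fun_eq_iff affine_H_def Let_def c_def n_def)
  have "affine_H p \<Omega> u \<zeta> powr (p - 1) * (grad (affine_H p \<Omega> u) \<zeta> \<bullet> \<zeta>) =
      c * (\<integral>\<xi>. directional_energy p \<Omega> u \<xi> powr (- (n + p) / p) * \<bar>\<xi> \<bullet> \<zeta>\<bar> powr p \<partial>sphere_measure)"
    unfolding H
    by (intro weighted_powr_Euler integrable_directional_energy_powr assms borel_measurable_sphere_measureI)
      (auto simp: c_def space_sphere_measure)
  then show ?thesis using False by (simp add: affine_flux_def c_def)
qed

text \<open>After an exchange of the two integrations the weight \<open>D\<^bsup>-(n+p)/p\<^esup>\<close>, with \<open>D\<close> the directional energy,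
  meets one more factor \<open>D\<close>. What remains is the integral \<open>J\<close> of \<open>D\<^bsup>-n/p\<^esup>\<close> that defines the energy
  \<open>E = \<alpha> J\<^bsup>-1/n\<^esup>\<close>, and \<open>\<alpha>\<^bsup>-n\<^esup> E\<^bsup>n+p\<^esup> J = E\<^sup>p\<close>.\<close>
lemma integral_affine_flux_inner_weak_grad:
  fixes \<Omega> :: "(real^'n) set"
  assumes "open \<Omega>" "bounded \<Omega>" "1 < p" "u \<in> W0_nonzero p \<Omega>"
  shows "(\<integral>x. affine_flux p \<Omega> u (weak_grad p \<Omega> u x) \<bullet> weak_grad p \<Omega> u x \<partial>lebesgue_on \<Omega>) =
    affine_energy p \<Omega> u powr p"
proof -
  let ?S = "sphere_measure :: (real^'n) measure" and ?M = "lebesgue_on \<Omega>"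
  define n where "n = real CARD('n)"
  define D where "D = directional_energy p \<Omega> u"
  define G where "G = weak_grad p \<Omega> u"
  define E where "E = affine_energy p \<Omega> u"
  define \<alpha> where "\<alpha> = alpha_const n p"
  define J where "J = (\<integral>\<xi>. D \<xi> powr (- n / p) \<partial>?S)"
  have n: "0 < n" by (simp add: n_def)
  interpret S: finite_measure ?S by (rule finite_measure_sphere_measure)
  interpret M: finite_measure ?M using assms by (intro finite_measure_lebesgue_on_open_bounded)
  interpret SM: pair_sigma_finite ?S ?M ..
  have u: "u \<in> W0 p \<Omega>" using assms by (simp add: W0_nonzero_def)
  have [measurable]: "G \<in> borel_measurable ?M"
    using weak_grad_W0[OF u] by (simp add: W0_gradient_def G_def)
  have [measurable]: "D \<in> borel_measurable ?S"
    unfolding D_def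
    by (intro borel_measurable_sphere_measureI borel_measurable_continuous_onI
      continuous_on_directional_energy assms u)
  have [measurable]: "(\<lambda>\<xi>. \<xi>) \<in> borel_measurable ?S"
    by (intro borel_measurable_sphere_measureI) simp
  have wD: "D \<xi> powr (- (n + p) / p) * D \<xi> = D \<xi> powr (- n / p)" if "\<xi> \<in> space ?S" for \<xi>
  proof -
    have "0 < D \<xi>"
      using that directional_energy_pos[OF assms] by (simp add: D_def space_sphere_measure)
    then have "D \<xi> powr (- (n + p) / p) * D \<xi> = D \<xi> powr (- (n + p) / p + 1)"
      by (simp add: powr_add)
    also have "- (n + p) / p + 1 = - n / p" using assms by (simp add: field_simps)
    finally show ?thesis .
  qed
  have iG: "integrable ?M (\<lambda>x. \<bar>\<xi> \<bullet> G x\<bar> powr p)" if "\<xi> \<in> space ?S" for \<xi>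
    using integrable_abs_inner_weak_grad_powr[OF assms(1-3) u] that
    by (simp add: G_def space_sphere_measure inner_commute[of \<xi>])
  have in1: "(\<integral>x. D \<xi> powr (- (n + p) / p) * \<bar>\<xi> \<bullet> G x\<bar> powr p \<partial>?M) = D \<xi> powr (- n / p)"
    if "\<xi> \<in> space ?S" for \<xi>
    using wD[OF that] by (simp add: D_def directional_energy_def G_def inner_commute[of \<xi>])
  have "integrable (?S \<Otimes>\<^sub>M ?M) (\<lambda>(\<xi>, x). D \<xi> powr (- (n + p) / p) * \<bar>\<xi> \<bullet> G x\<bar> powr p)"
  proof (rule SM.Fubini_integrable)
    have "integrable ?S (\<lambda>\<xi>. D \<xi> powr (- n / p))"
      unfolding D_def by (intro integrable_directional_energy_powr assms)
    then show "integrable ?S (\<lambda>\<xi>. \<integral>x. norm (case (\<xi>, x) of (\<xi>, x) \<Rightarrow>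
        D \<xi> powr (- (n + p) / p) * \<bar>\<xi> \<bullet> G x\<bar> powr p) \<partial>?M)"
    proof (rule Bochner_Integration.integrable_cong[THEN iffD1, OF refl, rotated])
      fix \<xi> assume "\<xi> \<in> space ?S"
      then show "D \<xi> powr (- n / p) = (\<integral>x. norm (case (\<xi>, x) of (\<xi>, x) \<Rightarrow>
        D \<xi> powr (- (n + p) / p) * \<bar>\<xi> \<bullet> G x\<bar> powr p) \<partial>?M)"
        using in1 by (simp add: abs_mult)
    qed
    show "AE \<xi> in ?S. integrable ?M (\<lambda>x. case (\<xi>, x) of (\<xi>, x) \<Rightarrow>
        D \<xi> powr (- (n + p) / p) * \<bar>\<xi> \<bullet> G x\<bar> powr p)"
      using iG by (intro AE_I2) auto
  qed measurable
  from SM.Fubini_integral[OF this]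
  have "(\<integral>x. (\<integral>\<xi>. D \<xi> powr (- (n + p) / p) * \<bar>\<xi> \<bullet> G x\<bar> powr p \<partial>?S) \<partial>?M) =
      (\<integral>\<xi>. (\<integral>x. D \<xi> powr (- (n + p) / p) * \<bar>\<xi> \<bullet> G x\<bar> powr p \<partial>?M) \<partial>?S)"
    by simp
  also have "\<dots> = J"
    unfolding J_def by (intro Bochner_Integration.integral_cong refl in1)
  finally have "(\<integral>x. affine_flux p \<Omega> u (G x) \<bullet> G x \<partial>?M) = \<alpha> powr (- n) * E powr (n + p) * J"
    unfolding affine_flux_inner_self[OF assms, folded n_def] by (simp add: \<alpha>_def E_def D_def)
  also have "\<dots> = E powr p"
  proof (cases "E = 0")
    case False
    have E: "E = \<alpha> * J powr (- 1 / n)"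
      using affine_energy_eq[OF assms] by (simp add: E_def \<alpha>_def J_def D_def n_def)
    have "0 \<le> \<alpha>" "0 \<le> J" by (simp_all add: \<alpha>_def alpha_const_def J_def)
    with False E have pos: "0 < \<alpha>" "0 < J" by (auto simp: less_le)
    have "E powr n = \<alpha> powr n * J powr (- 1)"
      using n by (simp add: E powr_mult powr_powr)
    then have "\<alpha> powr (- n) * E powr n * J = (\<alpha> powr (- n) * \<alpha> powr n) * (J powr (- 1) * J)"
      by (simp only: mult_ac)
    also have "\<dots> = 1" using pos by (simp add: powr_minus)
    finally have "\<alpha> powr (- n) * E powr n * J = 1" .
    then have "\<alpha> powr (- n) * (E powr n * E powr p) * J = E powr p"
      by (metis mult.commute mult.left_commute mult.right_neutral)
    then show ?thesis by (simp add: powr_add)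
  \<comment> \<open>Both sides vanish with the energy.\<close>
  qed (use assms in simp)
  finally show ?thesis by (simp add: G_def E_def)
qed

section \<open>Sign of the least energy\<close>

text \<open>Hoelder's inequality bounds the \<open>L\<^sup>q\<close> norm from below by the \<open>L\<^sup>p\<close> norm. Here
  \<open>t \<le> a + a\<^bsup>1-q/p\<^esup> t\<^bsup>q/p\<^esup>\<close> is integrated with \<open>t = |v|\<^sup>p\<close> and \<open>a\<close> so small that the constant
  term accounts for at most half of \<open>\<integral> |v|\<^sup>p = 1\<close>.\<close>
lemma integral_powr_lower_bound:
  fixes p q :: real
  assumes "finite_measure M" "0 < p" "p < q"
  obtains c where "0 < c" "\<And>v. (\<integral>x. \<bar>v x\<bar> powr p \<partial>M) = 1 \<Longrightarrow> integrable M (\<lambda>x. \<bar>v x\<bar> powr q) \<Longrightarrow>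
    c \<le> (\<integral>x. \<bar>v x\<bar> powr q \<partial>M)"
proof -
  interpret finite_measure M by fact
  define m where "m = measure M (space M)"
  define a where "a = 1 / (2 * (m + 1))"
  have m: "0 \<le> m" by (simp add: m_def)
  then have a: "0 < a" "a * m \<le> 1 / 2" by (auto simp: a_def field_simps)
  define b where "b = a powr (1 - q / p)"
  have b: "0 < b" using a by (simp add: b_def)
  show thesis
  proof
    show "0 < 1 / (2 * b)" using b by simp
    fix v :: "_ \<Rightarrow> real"
    assume v: "(\<integral>x. \<bar>v x\<bar> powr p \<partial>M) = 1" "integrable M (\<lambda>x. \<bar>v x\<bar> powr q)"
    have ip: "integrable M (\<lambda>x. \<bar>v x\<bar> powr p)"
      using v(1) not_integrable_integral_eq by fastforce
    have "1 = (\<integral>x. \<bar>v x\<bar> powr p \<partial>M)" using v by simp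
    also have "\<dots> \<le> (\<integral>x. a + b * \<bar>v x\<bar> powr q \<partial>M)"
    proof (rule integral_mono[OF ip])
      fix x
      show "\<bar>v x\<bar> powr p \<le> a + b * \<bar>v x\<bar> powr q"
        using le_add_powr[of a "\<bar>v x\<bar> powr p" "q / p"] a assms by (simp add: b_def powr_powr)
    qed (use v in simp)
    also have "\<dots> = a * m + b * (\<integral>x. \<bar>v x\<bar> powr q \<partial>M)"
      using v by (simp add: m_def)
    finally show "1 / (2 * b) \<le> (\<integral>x. \<bar>v x\<bar> powr q \<partial>M)"
      using a b by (simp add: field_simps)
  qed
qed

text \<open>Almost optimal functions for the eigenvalue, normalised in \<open>L\<^sup>p\<close>, have a numerator
  \<open>E\<^sup>p - \<lambda>\<close> smaller than any given positive number, while the denominator stays away from zero.\<close>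
lemma least_energy_level_nonpos:
  fixes \<Omega> :: "(real^'n) set"
  assumes "open \<Omega>" "bounded \<Omega>" "1 < p" "p < q" and lam: "affine_eigenvalue p \<Omega> \<le> ereal lam"
  shows "least_energy_level p q lam \<Omega> \<le> 0"
proof (rule ccontr)
  let ?M = "lebesgue_on \<Omega>"
  assume "\<not> least_energy_level p q lam \<Omega> \<le> 0"
  then obtain m :: real where m: "0 < m" "ereal m < least_energy_level p q lam \<Omega>"
    using ereal_dense3[of 0 "least_energy_level p q lam \<Omega>"]
    by (metis ereal_dense2 ereal_less(2) not_le)
  interpret M: finite_measure ?M using assms by (intro finite_measure_lebesgue_on_open_bounded)
  obtain c where c: "0 < c" "\<And>v. (\<integral>x. \<bar>v x\<bar> powr p \<partial>?M) = 1 \<Longrightarrow>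
      integrable ?M (\<lambda>x. \<bar>v x\<bar> powr q) \<Longrightarrow> c \<le> (\<integral>x. \<bar>v x\<bar> powr q \<partial>?M)"
    using integral_powr_lower_bound[OF M.finite_measure_axioms, of p q] assms by auto
  have "affine_eigenvalue p \<Omega> < ereal (lam + m * c powr (p / q))"
    using lam m c by (auto intro!: le_less_trans[OF lam])
  then obtain v where v: "v \<in> W0 p \<Omega>" "Lp_norm p \<Omega> v = 1"
      and E: "affine_energy p \<Omega> v powr p < lam + m * c powr (p / q)"
    unfolding affine_eigenvalue_def by (auto simp: INF_less_iff)
  have "(\<integral>x. \<bar>v x\<bar> powr p \<partial>?M) = Lp_norm p \<Omega> v powr p"
    using assms by (simp add: Lp_norm_def powr_powr)
  then have vp: "(\<integral>x. \<bar>v x\<bar> powr p \<partial>?M) = 1" using v by simp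
  have "\<not> (AE x in ?M. v x = 0)"
  proof
    assume "AE x in ?M. v x = 0"
    then have "(\<integral>x. \<bar>v x\<bar> powr p \<partial>?M) = 0"
      by (intro integral_eq_zero_AE) (auto elim: eventually_mono)
    then show False using vp by simp
  qed
  then have "least_energy_level p q lam \<Omega> \<le> ereal (energy_quotient p q lam \<Omega> v)"
    using v unfolding least_energy_level_def by (intro INF_lower) (simp add: W0_nonzero_def)
  then have quot: "m < energy_quotient p q lam \<Omega> v"
    using m by (metis ereal_less_eq(3) less_ereal.simps(1) order_less_le_trans)
  define Q where "Q = (\<integral>x. \<bar>v x\<bar> powr q \<partial>?M)"
  have eq: "energy_quotient p q lam \<Omega> v = (affine_energy p \<Omega> v powr p - lam) / Q powr (p / q)"
    by (simp add: energy_quotient_def vp Q_def)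
  \<comment> \<open>Division by zero yields zero, so a positive quotient forces \<open>Q \<noteq> 0\<close>; this in turn excludes that
    \<open>|v|\<^sup>q\<close> is not integrable, since \<open>Q\<close> would then be zero.\<close>
  have "Q \<noteq> 0" using quot m by (auto simp: eq)
  then have "integrable ?M (\<lambda>x. \<bar>v x\<bar> powr q)"
    using not_integrable_integral_eq unfolding Q_def by fastforce
  then have Q: "c \<le> Q" unfolding Q_def by (intro c(2) vp)
  have "m * c powr (p / q) \<le> m * Q powr (p / q)"
    using m c Q assms by (intro mult_left_mono powr_mono2) auto
  also have "\<dots> < affine_energy p \<Omega> v powr p - lam"
    using quot Q c by (simp add: eq pos_less_divide_eq)
  finally show False using E by simp
qed

text \<open>Tested with itself, a weak solution satisfies \<open>E\<^sup>p = Q + \<lambda> \<integral> u\<^sup>p\<close> with \<open>Q = \<integral> u\<^sup>q > 0\<close>, so that its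
  quotient is \<open>Q\<^bsup>1-p/q\<^esup>\<close>.\<close>
lemma weak_solution_energy_quotient_pos:
  fixes \<Omega> :: "(real^'n) set"
  assumes "open \<Omega>" "bounded \<Omega>" "1 < p" "p < q" and sol: "weak_solution p q lam \<Omega> u"
  shows "0 < energy_quotient p q lam \<Omega> u"
proof -
  let ?M = "lebesgue_on \<Omega>"
  have u: "u \<in> W0_nonzero p \<Omega>" and nonneg: "AE x in ?M. 0 \<le> u x"
    and test: "\<And>\<phi>. \<phi> \<in> W0 p \<Omega> \<Longrightarrow> integrable ?M (\<lambda>x. u x powr (q - 1) * \<phi> x) \<and>
        (\<integral>x. affine_flux p \<Omega> u (weak_grad p \<Omega> u x) \<bullet> weak_grad p \<Omega> \<phi> x \<partial>?M) =
        (\<integral>x. u x powr (q - 1) * \<phi> x \<partial>?M) + lam * (\<integral>x. u x powr (p - 1) * \<phi> x \<partial>?M)"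
    using sol by (auto simp: weak_solution_def)
  have W0: "u \<in> W0 p \<Omega>" using u by (simp add: W0_nonzero_def)
  have [measurable]: "u \<in> borel_measurable ?M"
    using W0 by (auto simp: W0_def W0_gradient_def)
  have ae: "AE x in ?M. u x powr (r - 1) * u x = \<bar>u x\<bar> powr r" for r
    using nonneg by eventually_elim (auto simp: powr_diff)
  have int: "(\<integral>x. u x powr (r - 1) * u x \<partial>?M) = (\<integral>x. \<bar>u x\<bar> powr r \<partial>?M)" for r
    by (intro integral_cong_AE ae) measurable
  define Q where "Q = (\<integral>x. \<bar>u x\<bar> powr q \<partial>?M)"
  have iq: "integrable ?M (\<lambda>x. \<bar>u x\<bar> powr q)"
    by (rule integrable_cong_AE[THEN iffD1, OF _ _ ae]) (use test[OF W0] in simp_all)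
  have "Q \<noteq> 0"
  proof
    assume "Q = 0"
    then have "AE x in ?M. \<bar>u x\<bar> powr q = 0"
      unfolding Q_def using iq by (subst (asm) integral_nonneg_eq_0_iff_AE) auto
    then show False using u by (simp add: W0_nonzero_def)
  qed
  then have Q: "0 < Q" by (simp add: less_le Q_def)
  have "affine_energy p \<Omega> u powr p = Q + lam * (\<integral>x. \<bar>u x\<bar> powr p \<partial>?M)"
    using test[OF W0] unfolding integral_affine_flux_inner_weak_grad[OF assms(1-3) u] int Q_def by simp
  then have "energy_quotient p q lam \<Omega> u = Q / Q powr (p / q)"
    by (simp add: energy_quotient_def Q_def)
  then show ?thesis using Q by simp
qed

theorem theorem1p4:
  fixes \<Omega> :: "(real^'n) set" and p q lam \<alpha> :: real
  assumes "2 \<le> CARD('n)"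
    and "1 < p" and "p < real CARD('n)"
    and "open \<Omega>" and "bounded \<Omega>"
    and "0 < \<alpha>" and "\<alpha> \<le> 1" and "C2_Holder_boundary \<alpha> \<Omega>"
    and "p < q" and "q \<le> real CARD('n) * p / (real CARD('n) - p)"
    and "affine_eigenvalue p \<Omega> \<le> ereal lam"
  shows "\<not> (\<exists>u. least_energy_weak_solution p q lam \<Omega> u)"
proof
  assume "\<exists>u. least_energy_weak_solution p q lam \<Omega> u"
  then obtain u where sol: "weak_solution p q lam \<Omega> u"
    and least: "ereal (energy_quotient p q lam \<Omega> u) = least_energy_level p q lam \<Omega>"
    by (auto simp: least_energy_weak_solution_def)
  have "0 < energy_quotient p q lam \<Omega> u"
    using assms sol by (intro weak_solution_energy_quotient_pos)
  moreover have "least_energy_level p q lam \<Omega> \<le> 0"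
    using assms by (intro least_energy_level_nonpos)
  ultimately show False by (simp flip: least)
qed

end
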